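(* Let $R$ be a commutative local ring, and let $A\in M_2(R)$. Then $A$ is strongly $P$-clean if and only if at least one of the following holds: (1) $A\in M_2(P(R))$; (2) $I_2-A\in M_2(P(R))$; (3) $A\in M_2(R)$ is strongly $\pi$-regular and $A$ is similar to a matrix $\begin{pmatrix}0&\lambda\\1&\mu\end{pmatrix}$, where $\lambda\in P(R)$ and $\mu\in 1+P(R)$.
   Context: Rings are associative with identity. $P(S)$ denotes the prime radical of a ring $S$ (the intersection of all prime ideals of $S$). $M_2(R)$ is the ring of $2\times2$ matrices over $R$ and $M_2(P(R))$ is the set of those with all entries in $P(R)$. An element $a$ of a ring $S$ is strongly $P$-clean if $a=e+w$ with $e=e^2\in S$, $w\in P(S)$ and $ew=we$; here this is applied with $S=M_2(R)$. An element $a$ of a ring $S$ is strongly $\pi$-regular if there exist an integer $m\ge1$ and $b\in S$ such that $a^m=a^{m+1}b$ and $ab=ba$. Similar means conjugate by an element of $GL_2(R)$. *)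

theory Defs
  imports
    "HOL-Algebra.Ideal_Product"
    "Jordan_Normal_Form.Matrix"
    "Jordan_Normal_Form.VS_Connect"
begin

definition local_cring :: "('a, 'b) ring_scheme \<Rightarrow> bool" where
  "local_cring R \<longleftrightarrow> cring R \<and> (\<exists>!M. maximalideal M R)"

text \<open>
  The library locale \<^locale>\<open>primeideal\<close> presupposes commutativity, so it cannot be used for
  matrix rings; the following is primeness for two-sided ideals of an arbitrary ring.
\<close>

definition nc_prime_ideal :: "'a set \<Rightarrow> ('a, 'b) ring_scheme \<Rightarrow> bool" where
  "nc_prime_ideal Q S \<longleftrightarrow> ideal Q S \<and> Q \<noteq> carrier S \<and>
     (\<forall>I J. ideal I S \<longrightarrow> ideal J S \<longrightarrow> I \<cdot>\<^bsub>S\<^esub> J \<subseteq> Q \<longrightarrow> I \<subseteq> Q \<or> J \<subseteq> Q)"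

definition prime_radical :: "('a, 'b) ring_scheme \<Rightarrow> 'a set" where
  "prime_radical S = {x \<in> carrier S. \<forall>Q. nc_prime_ideal Q S \<longrightarrow> x \<in> Q}"

definition strongly_P_clean :: "('a, 'b) ring_scheme \<Rightarrow> 'a \<Rightarrow> bool" where
  "strongly_P_clean S a \<longleftrightarrow>
     (\<exists>e \<in> carrier S. \<exists>w \<in> prime_radical S.
        e \<otimes>\<^bsub>S\<^esub> e = e \<and> a = e \<oplus>\<^bsub>S\<^esub> w \<and> e \<otimes>\<^bsub>S\<^esub> w = w \<otimes>\<^bsub>S\<^esub> e)"

definition strongly_pi_regular :: "('a, 'b) ring_scheme \<Rightarrow> 'a \<Rightarrow> bool" where
  "strongly_pi_regular S a \<longleftrightarrow> a \<in> carrier S \<and>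
     (\<exists>m::nat. m \<ge> 1 \<and> (\<exists>b \<in> carrier S.
        a [^]\<^bsub>S\<^esub> m = a [^]\<^bsub>S\<^esub> (m + 1) \<otimes>\<^bsub>S\<^esub> b \<and> a \<otimes>\<^bsub>S\<^esub> b = b \<otimes>\<^bsub>S\<^esub> a))"

definition M2_ring :: "'a::comm_ring_1 itself \<Rightarrow> 'a mat ring" where
  "M2_ring T = ring_mat T 2 ()"

definition M2_over :: "'a set \<Rightarrow> 'a mat set" where
  "M2_over X = {A \<in> carrier_mat 2 2. \<forall>i < 2. \<forall>j < 2. A $$ (i, j) \<in> X}"

end

theory Submission
  imports Defs "HOL-Algebra.QuotRing"
begin

text \<open>
  Every prime ideal of \<open>M\<^sub>2(R)\<close> is \<open>M\<^sub>2(Q)\<close> for a prime \<open>Q\<close> of \<open>R\<close>, so \<open>P(M\<^sub>2(R)) = M\<^sub>2(P(R))\<close>, and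
  \<open>P(R)\<close> consists of nilpotents. Over a local ring the trace and determinant of an idempotent
  \<open>E\<close> are both 0 or 1, so \<open>E\<close> is \<open>0\<close>, \<open>I\<close>, or has trace 1 and determinant 0. In the last case
  \<open>A = E + W\<close> has unit trace \<open>\<mu>\<close> and nilpotent determinant \<open>\<delta>\<close>. Such an \<open>A\<close> has a cyclic vector,
  hence is similar to its companion matrix, and Cayley--Hamilton gives
  \<open>A (I - \<mu>\<^sup>-\<^sup>1 A) = \<mu>\<^sup>-\<^sup>1 \<delta> I\<close>, which is nilpotent, so \<open>A\<close> is strongly pi-regular. Conversely, if \<open>A\<close> is similar
  to the companion matrix then \<open>A\<^sup>2 - A\<close> has entries in \<open>P(R)\<close>, and the Fitting idempotent
  provided by strong pi-regularity is congruent to \<open>A\<close>.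
\<close>

section \<open>Ideals of a commutative ring\<close>

text \<open>Negation is multiplication by -1, so closure under negation follows from absorption. All
  later ideal arguments in \<open>R\<close> use this elementwise form.\<close>

lemma ideal_class_ring_iff:
  "ideal I (class_ring :: 'a::comm_ring_1 ring) \<longleftrightarrow>
     0 \<in> I \<and> (\<forall>x\<in>I. \<forall>y\<in>I. x + y \<in> I) \<and> (\<forall>x\<in>I. \<forall>r. r * x \<in> I)"
proof (intro iffI conjI ballI allI)
  assume I: "ideal I (class_ring :: 'a ring)"
  interpret ideal I "class_ring :: 'a ring" by fact
  show "0 \<in> I" using zero_closed by simp
  show "x + y \<in> I" if "x \<in> I" "y \<in> I" for x y using a_closed[OF that] by simp
  show "r * x \<in> I" if "x \<in> I" for x r using I_l_closed[OF that, of r] by simp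
next
  assume I: "0 \<in> I \<and> (\<forall>x\<in>I. \<forall>y\<in>I. x + y \<in> I) \<and> (\<forall>x\<in>I. \<forall>r. r * x \<in> I)"
  have neg: "- x \<in> I" if "x \<in> I" for x
    using I that by (metis mult_minus1)
  show "ideal I (class_ring :: 'a ring)"
  proof (rule idealI)
    show "ring (class_ring :: 'a ring)" by (rule class_ring.ring_axioms)
    show "subgroup I (add_monoid (class_ring :: 'a ring))"
    proof (rule group.subgroupI)
      show "group (add_monoid (class_ring :: 'a ring))"
        by (rule abelian_group.a_group[OF ring.is_abelian_group[OF class_ring.ring_axioms]])
      show "inv\<^bsub>add_monoid (class_ring :: 'a ring)\<^esub> x \<in> I" if "x \<in> I" for x
      proof -
        have "\<ominus>\<^bsub>class_ring\<^esub> x = - x" by (simp add: class_ring_simps)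
        then show ?thesis unfolding a_inv_def using neg[OF that] by metis
      qed
    qed (use I in auto)
  qed (use I in \<open>auto simp: mult.commute\<close>)
qed

text \<open>Zorn's lemma, applied below with \<open>S\<close> = {1} to get maximal ideals and with
  \<open>S\<close> the powers of an element to get prime ideals.\<close>

lemma ideal_maximal_disjoint:
  fixes I :: "'a::comm_ring_1 set"
  assumes "ideal I (class_ring :: 'a ring)" "I \<inter> S = {}"
  obtains M where "ideal M (class_ring :: 'a ring)" "I \<subseteq> M" "M \<inter> S = {}"
    "\<And>J. ideal J (class_ring :: 'a ring) \<Longrightarrow> M \<subseteq> J \<Longrightarrow> J \<inter> S = {} \<Longrightarrow> J = M"
proof -
  define F where "F = {J. ideal J (class_ring :: 'a ring) \<and> I \<subseteq> J \<and> J \<inter> S = {}}"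
  have "\<exists>M\<in>F. \<forall>X\<in>F. M \<subseteq> X \<longrightarrow> X = M"
  proof (rule subset_Zorn)
    fix C assume C: "subset.chain F C"
    show "\<exists>U\<in>F. \<forall>X\<in>C. X \<subseteq> U"
    proof (cases "C = {}")
      case True
      then show ?thesis using assms by (auto simp: F_def)
    next
      case False
      have CF: "C \<subseteq> F" and lin: "\<And>X Y. X \<in> C \<Longrightarrow> Y \<in> C \<Longrightarrow> X \<subseteq> Y \<or> Y \<subseteq> X"
        using C by (auto simp: subset_chain_def)
      have idl: "ideal X (class_ring :: 'a ring)" if "X \<in> C" for X
        using that CF by (auto simp: F_def)
      have "ideal (\<Union>C) (class_ring :: 'a ring)"
        unfolding ideal_class_ring_iff
      proof (intro conjI ballI allI)
        show "0 \<in> \<Union>C" using False idl by (auto simp: ideal_class_ring_iff)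
      next
        fix x y assume "x \<in> \<Union>C" "y \<in> \<Union>C"
        then obtain X Y where XY: "X \<in> C" "x \<in> X" "Y \<in> C" "y \<in> Y" by blast
        then obtain Z where "Z \<in> C" "x \<in> Z" "y \<in> Z" using lin[of X Y] by blast
        then show "x + y \<in> \<Union>C" using idl[of Z] by (auto simp: ideal_class_ring_iff)
      next
        fix x r assume "x \<in> \<Union>C"
        then show "r * x \<in> \<Union>C" using idl unfolding ideal_class_ring_iff by blast
      qed
      moreover have "I \<subseteq> \<Union>C" "\<Union>C \<inter> S = {}"
        using False CF by (auto simp: F_def)
      ultimately have "\<Union>C \<in> F" by (auto simp: F_def)
      then show ?thesis by blast
    qed
  qed
  then obtain M where M: "M \<in> F" and max: "\<And>X. X \<in> F \<Longrightarrow> M \<subseteq> X \<Longrightarrow> X = M" by blast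
  show thesis
  proof (rule that[of M])
    show "J = M" if "ideal J (class_ring :: 'a ring)" "M \<subseteq> J" "J \<inter> S = {}" for J
      using max[of J] M that unfolding F_def by blast
  qed (use M in \<open>auto simp: F_def\<close>)
qed

text \<open>The multiples of a nonunit avoid 1, and an ideal maximal among those avoiding 1 is
  maximal, because any ideal containing 1 is everything.\<close>

lemma nonunit_in_maximalideal:
  fixes x :: "'a::comm_ring_1"
  assumes "\<not> x dvd 1"
  obtains M where "maximalideal M (class_ring :: 'a ring)" "x \<in> M"
proof -
  have "ideal (range (\<lambda>r. r * x)) (class_ring :: 'a ring)"
    unfolding ideal_class_ring_iff
    by (auto simp: image_iff simp flip: distrib_right mult.assoc) (metis mult_zero_left)
  moreover have "range (\<lambda>r. r * x) \<inter> {1} = {}"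
    using assms by (auto simp: dvd_def mult.commute)
  ultimately obtain M where M: "ideal M (class_ring :: 'a ring)" "range (\<lambda>r. r * x) \<subseteq> M"
      "M \<inter> {1} = {}"
      and max: "\<And>J. ideal J (class_ring :: 'a ring) \<Longrightarrow> M \<subseteq> J \<Longrightarrow> J \<inter> {1} = {} \<Longrightarrow> J = M"
    by (rule ideal_maximal_disjoint) blast
  have "x \<in> M" using M(2) by (metis mult_1 rangeI subsetD)
  moreover have "maximalideal M (class_ring :: 'a ring)"
  proof (rule maximalidealI)
    fix J assume J: "ideal J (class_ring :: 'a ring)" "M \<subseteq> J"
    have "J = UNIV" if "1 \<in> J"
    proof -
      have "r * 1 \<in> J" for r using J(1) that unfolding ideal_class_ring_iff by blast
      then show ?thesis by auto
    qed
    then show "J = M \<or> J = carrier (class_ring :: 'a ring)"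
      using max[OF J] by auto
  qed (use M in auto)
  ultimately show thesis using that by blast
qed

text \<open>Both nonunits lie in the one maximal ideal, which is closed under addition and contains
  no unit.\<close>

lemma local_cring_nonunit_add:
  fixes x y :: "'a::comm_ring_1"
  assumes loc: "local_cring (class_ring :: 'a ring)" and "\<not> x dvd 1" "\<not> y dvd 1"
  shows "\<not> x + y dvd 1"
proof
  assume "x + y dvd 1"
  then obtain r where r: "1 = r * (x + y)" by (metis dvd_def mult.commute)
  obtain M where M: "maximalideal M (class_ring :: 'a ring)" "x \<in> M"
    using nonunit_in_maximalideal assms(2) by blast
  obtain M' where M': "maximalideal M' (class_ring :: 'a ring)" "y \<in> M'"
    using nonunit_in_maximalideal assms(3) by blast
  have "M' = M" using loc M(1) M'(1) unfolding local_cring_def by blast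
  moreover have I: "ideal M (class_ring :: 'a ring)" using M(1) by (rule maximalideal.axioms)
  ultimately have "x + y \<in> M" using M(2) M'(2) unfolding ideal_class_ring_iff by blast
  then have "s * (r * (x + y)) \<in> M" for s using I unfolding ideal_class_ring_iff by blast
  then have "M = UNIV" by (auto simp flip: r)
  then show False using maximalideal.I_notcarr[OF M(1)] by auto
qed

text \<open>\<open>x\<close> and \<open>1 - x\<close> sum to 1, so one of them is a unit; their
  product is 0, so the other one vanishes.\<close>

lemma local_cring_idempotent:
  fixes x :: "'a::comm_ring_1"
  assumes loc: "local_cring (class_ring :: 'a ring)" and idem: "x * x = x"
  shows "x = 0 \<or> x = 1"
proof -
  have z: "x * (1 - x) = 0" using idem by (simp add: algebra_simps)
  have "x dvd 1 \<or> 1 - x dvd 1"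
    using local_cring_nonunit_add[OF loc, of x "1 - x"] by auto
  then show ?thesis
  proof
    assume "x dvd 1"
    then obtain k where "1 = x * k" by (auto simp: dvd_def)
    then have "1 - x = k * (x * (1 - x))" by (metis mult.assoc mult.commute mult_1)
    then show ?thesis using z by simp
  next
    assume "1 - x dvd 1"
    then obtain k where "1 = (1 - x) * k" by (auto simp: dvd_def)
    then have "x = k * (x * (1 - x))" by (metis mult.assoc mult.commute mult_1)
    then show ?thesis using z by simp
  qed
qed

section \<open>The prime radical of a commutative ring\<close>

text \<open>By commutativity the product of the principal ideals of \<open>x\<close> and
  \<open>y\<close> consists of multiples of \<open>x * y\<close>, so ideal-wise primeness applies to
  these two ideals.\<close>

lemma nc_prime_ideal_completely_prime:
  fixes x y :: "'a::comm_ring_1"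
  assumes Q: "nc_prime_ideal Q (class_ring :: 'a ring)" and "x * y \<in> Q"
  shows "x \<in> Q \<or> y \<in> Q"
proof -
  have I: "ideal Q (class_ring :: 'a ring)" using Q by (simp add: nc_prime_ideal_def)
  have pr: "ideal (range (\<lambda>r. r * z)) (class_ring :: 'a ring)" for z
    unfolding ideal_class_ring_iff
    by (auto simp: image_iff simp flip: distrib_right mult.assoc) (metis mult_zero_left)
  have "range (\<lambda>r. r * x) \<cdot>\<^bsub>class_ring\<^esub> range (\<lambda>r. r * y) \<subseteq> Q"
  proof
    fix s assume "s \<in> range (\<lambda>r. r * x) \<cdot>\<^bsub>class_ring\<^esub> range (\<lambda>r. r * y)"
    then show "s \<in> Q"
    proof induction
      case (prod i j)
      then obtain r t where "i = r * x" "j = t * y" by blast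
      then have "i * j = (r * t) * (x * y)" by (simp add: ac_simps)
      then show ?case using I \<open>x * y \<in> Q\<close> by (simp add: ideal_class_ring_iff)
    qed (use I in \<open>auto simp: ideal_class_ring_iff\<close>)
  qed
  then have "range (\<lambda>r. r * x) \<subseteq> Q \<or> range (\<lambda>r. r * y) \<subseteq> Q"
    using Q pr unfolding nc_prime_ideal_def by blast
  then show ?thesis by (metis mult_1 rangeI subsetD)
qed

lemma ideal_prime_radical: "ideal (prime_radical class_ring) (class_ring :: 'a::comm_ring_1 ring)"
  by (auto simp: ideal_class_ring_iff prime_radical_def nc_prime_ideal_def)

text \<open>If no power of \<open>x\<close> is 0, an ideal maximal among those missing all powers of
  \<open>x\<close> exists and is prime; it would then have to contain \<open>x\<close>.\<close>

lemma prime_radical_nilpotent: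
  fixes x :: "'a::comm_ring_1"
  assumes "x \<in> prime_radical (class_ring :: 'a ring)"
  shows "\<exists>n. x ^ n = 0"
proof (rule ccontr)
  assume nn: "\<not> ?thesis"
  define S where "S = range (\<lambda>n::nat. x ^ n)"
  have "ideal {0} (class_ring :: 'a ring)" by (simp add: ideal_class_ring_iff)
  moreover have "{0} \<inter> S = {}" using nn by (auto simp: S_def)
  ultimately obtain M where M: "ideal M (class_ring :: 'a ring)" "M \<inter> S = {}"
      and max: "\<And>J. ideal J (class_ring :: 'a ring) \<Longrightarrow> M \<subseteq> J \<Longrightarrow> J \<inter> S = {} \<Longrightarrow> J = M"
    by (rule ideal_maximal_disjoint) blast
  \<comment> \<open>For \<open>a\<close> outside \<open>M\<close>, the ideal generated by
    \<open>M\<close> and \<open>a\<close> is strictly larger, so by maximality it meets the powers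
    of \<open>x\<close>.\<close>
  have hit: "\<exists>m\<in>M. \<exists>r n. m + r * a = x ^ n" if "a \<notin> M" for a
  proof (rule ccontr)
    assume *: "\<not> ?thesis"
    define J where "J = {m + r * a | m r. m \<in> M}"
    have JI: "m + r * a \<in> J" if "m \<in> M" for m r using that by (auto simp: J_def)
    have MJ: "m \<in> J" if "m \<in> M" for m using JI[OF that, of 0] by simp
    have "ideal J (class_ring :: 'a ring)"
      unfolding ideal_class_ring_iff
    proof (intro conjI ballI allI)
      show "0 \<in> J" using M(1) MJ unfolding ideal_class_ring_iff by blast
    next
      fix u v assume "u \<in> J" "v \<in> J"
      then obtain m r m' r' where "u = m + r * a" "v = m' + r' * a" "m \<in> M" "m' \<in> M"
        by (auto simp: J_def)
      moreover have "m + r * a + (m' + r' * a) = (m + m') + (r + r') * a"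
        by (simp add: algebra_simps)
      ultimately show "u + v \<in> J" using JI[of "m + m'" "r + r'"] M(1)
        unfolding ideal_class_ring_iff by metis
    next
      fix u s assume "u \<in> J"
      then obtain m r where "u = m + r * a" "m \<in> M" by (auto simp: J_def)
      then show "s * u \<in> J" using JI[of "s * m" "s * r"] M(1)
        by (simp add: ideal_class_ring_iff algebra_simps)
    qed
    moreover have "J \<inter> S = {}" using * by (auto simp: J_def S_def) metis
    ultimately have "J = M" using max MJ by blast
    moreover have "a \<in> J" using JI[of 0 1] M(1) by (simp add: ideal_class_ring_iff)
    ultimately show False using that by simp
  qed
  have "nc_prime_ideal M (class_ring :: 'a ring)"
    unfolding nc_prime_ideal_def
  proof (intro conjI allI impI)
    show "M \<noteq> carrier (class_ring :: 'a ring)" using M(2) by (auto simp: S_def)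
  next
    fix I J assume I: "ideal I (class_ring :: 'a ring)" and J: "ideal J (class_ring :: 'a ring)"
      and IJ: "I \<cdot>\<^bsub>class_ring\<^esub> J \<subseteq> M"
    show "I \<subseteq> M \<or> J \<subseteq> M"
    proof (rule ccontr)
      assume "\<not> ?thesis"
      then obtain a b where ab: "a \<in> I" "a \<notin> M" "b \<in> J" "b \<notin> M" by blast
      obtain m r i where 1: "m \<in> M" "m + r * a = x ^ i" using hit[OF ab(2)] by blast
      obtain m' r' j where 2: "m' \<in> M" "m' + r' * b = x ^ j" using hit[OF ab(4)] by blast
      have "a * b \<in> M"
        using IJ ideal_prod.prod[OF ab(1) ab(3), of class_ring] by auto
      \<comment> \<open>Multiplying the two representations leaves only terms with a factor
        \<open>m\<close>, \<open>m'\<close> or \<open>a * b\<close>, all of which lie in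
        \<open>M\<close>.\<close>
      moreover have "x ^ (i + j) = (m' + r' * b) * m + ((r * a) * m' + (r * r') * (a * b))"
        by (simp add: power_add flip: 1(2) 2(2)) (simp add: algebra_simps)
      ultimately have "x ^ (i + j) \<in> M"
        using M(1) 1(1) 2(1) by (simp add: ideal_class_ring_iff)
      then show False using M(2) by (auto simp: S_def)
    qed
  qed (rule M(1))
  then have "x ^ 1 \<in> M" using assms by (simp add: prime_radical_def)
  then show False using M(2) unfolding S_def by blast
qed

section \<open>Two-by-two matrices\<close>

text \<open>Named entries let the simplifier reduce matrix identities to identities in
  \<open>R\<close>; the body has the form of the companion matrix in the final theorem, so unfolding
  connects the two.\<close>

definition mat22 :: "'a \<Rightarrow> 'a \<Rightarrow> 'a \<Rightarrow> 'a \<Rightarrow> 'a mat" where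
  "mat22 a b c d = mat_of_rows_list 2 [[a, b], [c, d]]"

lemma mat22_carrier [simp]: "mat22 a b c d \<in> carrier_mat 2 2"
  by (rule carrier_matI) (simp_all add: mat22_def mat_of_rows_list_def)

lemma mat22_dim [simp]: "dim_row (mat22 a b c d) = 2" "dim_col (mat22 a b c d) = 2"
  by (simp_all add: mat22_def mat_of_rows_list_def)

lemma mat22_index [simp]:
  "mat22 a b c d $$ (0, 0) = a" "mat22 a b c d $$ (0, Suc 0) = b"
  "mat22 a b c d $$ (Suc 0, 0) = c" "mat22 a b c d $$ (Suc 0, Suc 0) = d"
  by (simp_all add: mat22_def mat_of_rows_list_def)

lemma mat22_cases:
  assumes "A \<in> carrier_mat 2 2"
  obtains a b c d where "A = mat22 a b c d"
proof (rule that)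
  show "A = mat22 (A $$ (0, 0)) (A $$ (0, 1)) (A $$ (1, 0)) (A $$ (1, 1))"
    by (rule eq_matI) (use assms in \<open>auto simp: less_2_cases_iff\<close>)
qed

lemma mat22_eq_iff [simp]:
  "mat22 a b c d = mat22 a' b' c' d' \<longleftrightarrow> a = a' \<and> b = b' \<and> c = c' \<and> d = d'"
  by (metis mat22_index)

lemma mat22_ops [simp]:
  fixes a :: "'a::comm_ring_1"
  shows "mat22 a b c d + mat22 a' b' c' d' = mat22 (a + a') (b + b') (c + c') (d + d')"
    "mat22 a b c d - mat22 a' b' c' d' = mat22 (a - a') (b - b') (c - c') (d - d')"
    "mat22 a b c d * mat22 a' b' c' d' =
       mat22 (a * a' + b * c') (a * b' + b * d') (c * a' + d * c') (c * b' + d * d')"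
proof -
  have [simp]: "{0..<2::nat} = {0, 1}" by auto
  show "mat22 a b c d + mat22 a' b' c' d' = mat22 (a + a') (b + b') (c + c') (d + d')"
    "mat22 a b c d - mat22 a' b' c' d' = mat22 (a - a') (b - b') (c - c') (d - d')"
    "mat22 a b c d * mat22 a' b' c' d' =
       mat22 (a * a' + b * c') (a * b' + b * d') (c * a' + d * c') (c * b' + d * d')"
    by (auto intro!: eq_matI simp: less_2_cases_iff scalar_prod_def)
qed

lemma mat22_one: "1\<^sub>m 2 = mat22 1 0 0 (1 :: 'a::comm_ring_1)"
  and mat22_zero: "0\<^sub>m 2 2 = mat22 0 0 0 (0 :: 'a)"
  by (auto intro!: eq_matI simp: less_2_cases_iff)

lemma mat22_in_M2_over [simp]:
  "mat22 a b c d \<in> M2_over X \<longleftrightarrow> a \<in> X \<and> b \<in> X \<and> c \<in> X \<and> d \<in> X"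
  by (auto simp: M2_over_def less_2_cases_iff)

lemma M2_ring_simps [simp]:
  "mult (M2_ring TYPE('a::comm_ring_1)) = (*)" "add (M2_ring TYPE('a)) = (+)"
  "one (M2_ring TYPE('a)) = mat22 1 0 0 1" "zero (M2_ring TYPE('a)) = mat22 0 0 0 0"
  "carrier (M2_ring TYPE('a)) = carrier_mat 2 2"
  by (simp_all add: M2_ring_def ring_mat_simps mat22_one mat22_zero)

lemma ring_M2_ring: "ring (M2_ring TYPE('a::comm_ring_1))"
  unfolding M2_ring_def by (rule ring_mat)

text \<open>Subtraction in the ring record is derived from its additive inverse, while matrices have
  their own \<open>-\<close>. Both give \<open>A\<close> after adding \<open>B\<close>, and
  \<open>B\<close> cancels.\<close>

lemma M2_ring_minus:
  assumes "A \<in> carrier_mat 2 2" "B \<in> carrier_mat 2 2"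
  shows "A \<ominus>\<^bsub>M2_ring TYPE('a::comm_ring_1)\<^esub> B = A - B"
proof -
  interpret ring "M2_ring TYPE('a)" by (rule ring_M2_ring)
  have "(A - B) \<oplus>\<^bsub>M2_ring TYPE('a)\<^esub> B = A"
    using assms by (elim mat22_cases) simp
  moreover have "(A \<ominus>\<^bsub>M2_ring TYPE('a)\<^esub> B) \<oplus>\<^bsub>M2_ring TYPE('a)\<^esub> B = A"
    using assms a_inv_closed[of B] a_assoc[of A "\<ominus>\<^bsub>M2_ring TYPE('a)\<^esub> B" B] l_neg[of B] r_zero[of A]
    by (simp add: a_minus_def)
  ultimately show ?thesis
    using add.right_cancel[of B "A - B" "A \<ominus>\<^bsub>M2_ring TYPE('a)\<^esub> B"] assms
      minus_closed[of A B] minus_carrier_mat[of B 2 2 A] by auto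
qed

section \<open>Ideals and prime radical of the matrix ring\<close>

lemma ideal_M2_ring_iff:
  "ideal I (M2_ring TYPE('a::comm_ring_1)) \<longleftrightarrow>
     I \<subseteq> carrier_mat 2 2 \<and> mat22 0 0 0 0 \<in> I \<and> (\<forall>X\<in>I. \<forall>Y\<in>I. X + Y \<in> I) \<and>
     (\<forall>X\<in>I. \<forall>Y\<in>carrier_mat 2 2. Y * X \<in> I \<and> X * Y \<in> I)"
proof (intro iffI conjI ballI allI)
  assume I: "ideal I (M2_ring TYPE('a))"
  interpret ideal I "M2_ring TYPE('a)" by fact
  show "I \<subseteq> carrier_mat 2 2" using a_subset by simp
  show "mat22 0 0 0 0 \<in> I"
    using additive_subgroup.zero_closed[OF is_additive_subgroup] by simp
  show "X + Y \<in> I" if "X \<in> I" "Y \<in> I" for X Y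
    using additive_subgroup.a_closed[OF is_additive_subgroup that] by simp
  show "Y * X \<in> I" "X * Y \<in> I" if "X \<in> I" "Y \<in> carrier_mat 2 2" for X Y
    using I_l_closed[of X Y] I_r_closed[of X Y] that by simp_all
next
  assume I: "I \<subseteq> carrier_mat 2 2 \<and> mat22 0 0 0 0 \<in> I \<and> (\<forall>X\<in>I. \<forall>Y\<in>I. X + Y \<in> I) \<and>
     (\<forall>X\<in>I. \<forall>Y\<in>carrier_mat 2 2. Y * X \<in> I \<and> X * Y \<in> I)"
  interpret ring "M2_ring TYPE('a)" by (rule ring_M2_ring)
  show "ideal I (M2_ring TYPE('a))"
  proof (rule idealI)
    show "subgroup I (add_monoid (M2_ring TYPE('a)))"
    proof (rule group.subgroupI)
      show "group (add_monoid (M2_ring TYPE('a)))" by (rule a_group)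
      show "inv\<^bsub>add_monoid (M2_ring TYPE('a))\<^esub> X \<in> I" if "X \<in> I" for X
      proof -
        have X: "X \<in> carrier_mat 2 2" using I that by blast
        \<comment> \<open>The additive inverse is multiplication by the scalar matrix of -1, so
          absorption gives closure under it.\<close>
        have "mat22 (-1) 0 0 (-1) * X \<oplus>\<^bsub>M2_ring TYPE('a)\<^esub> X = \<zero>\<^bsub>M2_ring TYPE('a)\<^esub>"
          using X by (elim mat22_cases) simp
        then have "\<ominus>\<^bsub>M2_ring TYPE('a)\<^esub> X = mat22 (-1) 0 0 (-1) * X"
          using X minus_equality[of "mat22 (-1) 0 0 (-1) * X" X]
          by (metis M2_ring_simps(1,5) m_closed mat22_carrier)
        then show ?thesis unfolding a_inv_def using I that by simp
      qed
      show "I \<noteq> {}" using I by blast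
    qed (use I in auto)
  qed (use I in \<open>auto intro: ring_axioms\<close>)
qed

lemma ideal_M2_over:
  assumes "ideal I (class_ring :: 'a::comm_ring_1 ring)"
  shows "ideal (M2_over I) (M2_ring TYPE('a))"
  unfolding ideal_M2_ring_iff
proof (intro conjI ballI)
  have I: "0 \<in> I" "\<And>x y. x \<in> I \<Longrightarrow> y \<in> I \<Longrightarrow> x + y \<in> I" "\<And>r x. x \<in> I \<Longrightarrow> r * x \<in> I"
    "\<And>r x. x \<in> I \<Longrightarrow> x * r \<in> I"
    using assms unfolding ideal_class_ring_iff by (blast, blast, blast, metis mult.commute)
  show sub: "M2_over I \<subseteq> carrier_mat 2 2" by (auto simp: M2_over_def)
  show "mat22 0 0 0 0 \<in> M2_over I" by (simp add: I)
  show "X + Y \<in> M2_over I" if XY: "X \<in> M2_over I" "Y \<in> M2_over I" for X Y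
  proof -
    obtain a b c d where "X = mat22 a b c d" using XY sub mat22_cases by blast
    moreover obtain a' b' c' d' where "Y = mat22 a' b' c' d'" using XY sub mat22_cases by blast
    ultimately show ?thesis using XY by (simp add: I)
  qed
  fix X Y :: "'a mat" assume XY: "X \<in> M2_over I" "Y \<in> carrier_mat 2 2"
  obtain a b c d where "X = mat22 a b c d" using XY sub mat22_cases by blast
  moreover obtain a' b' c' d' where "Y = mat22 a' b' c' d'" using XY sub mat22_cases by blast
  ultimately show "Y * X \<in> M2_over I" "X * Y \<in> M2_over I" using XY by (simp_all add: I)
qed


text \<open>For one inclusion, \<open>M2_over Q\<close> is prime whenever \<open>Q\<close> is. For
  the other, each prime \<open>Q'\<close> of the matrix ring contains \<open>M2_over Q\<close> for
  some prime \<open>Q\<close> of \<open>R\<close>.\<close>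

lemma prime_radical_M2_ring:
  "prime_radical (M2_ring TYPE('a::comm_ring_1)) = M2_over (prime_radical (class_ring :: 'a ring))"
proof (intro equalityI subsetI)
  fix W assume W: "W \<in> prime_radical (M2_ring TYPE('a))"
  then have "W \<in> carrier_mat 2 2" by (simp add: prime_radical_def)
  then obtain a b c d where Wm: "W = mat22 a b c d" by (rule mat22_cases)
  have "W \<in> M2_over Q" if Q: "nc_prime_ideal Q (class_ring :: 'a ring)" for Q
  proof -
    have I: "ideal Q (class_ring :: 'a ring)" and ne: "Q \<noteq> UNIV"
      using Q by (auto simp: nc_prime_ideal_def)
    have "nc_prime_ideal (M2_over Q) (M2_ring TYPE('a))"
      unfolding nc_prime_ideal_def
    proof (intro conjI allI impI)
      show "ideal (M2_over Q) (M2_ring TYPE('a))" by (rule ideal_M2_over[OF I])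
      obtain x where "x \<notin> Q" using ne by blast
      then have "mat22 x x x x \<notin> M2_over Q" by simp
      then show "M2_over Q \<noteq> carrier (M2_ring TYPE('a))" by (metis M2_ring_simps(5) mat22_carrier)
    next
      fix I J assume I: "ideal I (M2_ring TYPE('a))" and J: "ideal J (M2_ring TYPE('a))"
        and IJ: "I \<cdot>\<^bsub>M2_ring TYPE('a)\<^esub> J \<subseteq> M2_over Q"
      show "I \<subseteq> M2_over Q \<or> J \<subseteq> M2_over Q"
      proof (rule ccontr)
        assume "\<not> ?thesis"
        then obtain X Y where XY: "X \<in> I" "X \<notin> M2_over Q" "Y \<in> J" "Y \<notin> M2_over Q" by blast
        have sand: "X * Z * Y \<in> M2_over Q" if "Z \<in> carrier_mat 2 2" for Z
        proof -
          have "X * Z \<in> I" using I XY(1) that by (simp add: ideal_M2_ring_iff)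
          then show ?thesis
            using IJ ideal_prod.prod[of "X * Z" I Y J "M2_ring TYPE('a)"] XY(3) by auto
        qed
        have "X \<in> carrier_mat 2 2" "Y \<in> carrier_mat 2 2"
          using I J XY by (auto simp: ideal_M2_ring_iff)
        then obtain x1 x2 x3 x4 y1 y2 y3 y4
          where X: "X = mat22 x1 x2 x3 x4" and Y: "Y = mat22 y1 y2 y3 y4"
          by (metis mat22_cases)
        \<comment> \<open>Sandwiching the four matrix units gives all products of an entry of X with one of Y.\<close>
        have "x * y \<in> Q" if "x \<in> {x1, x2, x3, x4}" "y \<in> {y1, y2, y3, y4}" for x y
          using sand[of "mat22 1 0 0 0"] sand[of "mat22 0 1 0 0"]
            sand[of "mat22 0 0 1 0"] sand[of "mat22 0 0 0 1"] that
          by (auto simp: X Y)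
        moreover obtain x where "x \<in> {x1, x2, x3, x4}" "x \<notin> Q" using XY(2) by (auto simp: X)
        moreover obtain y where "y \<in> {y1, y2, y3, y4}" "y \<notin> Q" using XY(4) by (auto simp: Y)
        ultimately show False using nc_prime_ideal_completely_prime[OF Q] by blast
      qed
    qed
    then show ?thesis using W by (simp add: prime_radical_def)
  qed
  then show "W \<in> M2_over (prime_radical (class_ring :: 'a ring))"
    by (auto simp: Wm prime_radical_def)
next
  fix W assume W: "W \<in> M2_over (prime_radical (class_ring :: 'a ring))"
  then have Wc: "W \<in> carrier_mat 2 2" by (simp add: M2_over_def)
  have "W \<in> Q'" if Q': "nc_prime_ideal Q' (M2_ring TYPE('a))" for Q'
  proof -
    have I': "ideal Q' (M2_ring TYPE('a))" and ne: "Q' \<noteq> carrier_mat 2 2"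
      using Q' by (auto simp: nc_prime_ideal_def)
    have mult: "Y * X \<in> Q'" "X * Y \<in> Q'" if "X \<in> Q'" "Y \<in> carrier_mat 2 2" for X Y
      using I' that by (auto simp: ideal_M2_ring_iff)
    have add: "X + Y \<in> Q'" if "X \<in> Q'" "Y \<in> Q'" for X Y
      using I' that by (auto simp: ideal_M2_ring_iff)
    \<comment> \<open>The contraction of \<open>Q'\<close> along the embedding of \<open>R\<close>
      as scalar matrices.\<close>
    define Q where "Q = {x. mat22 x 0 0 x \<in> Q'}"
    have Q: "ideal Q (class_ring :: 'a ring)"
      unfolding ideal_class_ring_iff
    proof (intro conjI ballI allI)
      show "0 \<in> Q" using I' by (simp add: Q_def ideal_M2_ring_iff)
      show "x + y \<in> Q" if "x \<in> Q" "y \<in> Q" for x y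
        using add[of "mat22 x 0 0 x" "mat22 y 0 0 y"] that by (simp add: Q_def)
      show "r * x \<in> Q" if "x \<in> Q" for x r
        using mult(1)[of "mat22 x 0 0 x" "mat22 r 0 0 r"] that by (simp add: Q_def)
    qed
    have over: "X \<in> Q'" if X: "X \<in> M2_over Q" for X
    proof -
      have "X \<in> carrier_mat 2 2" using X by (simp add: M2_over_def)
      then obtain a b c d where Xm: "X = mat22 a b c d" by (rule mat22_cases)
      have s: "mat22 a 0 0 a \<in> Q'" "mat22 b 0 0 b \<in> Q'" "mat22 c 0 0 c \<in> Q'" "mat22 d 0 0 d \<in> Q'"
        using X by (auto simp: Xm Q_def)
      \<comment> \<open>Multiplying a scalar matrix by a matrix unit puts its entry in one chosen
        position; the four results add up to \<open>X\<close>.\<close>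
      have "mat22 a 0 0 0 \<in> Q'" "mat22 0 b 0 0 \<in> Q'" "mat22 0 0 c 0 \<in> Q'" "mat22 0 0 0 d \<in> Q'"
        using mult(1)[OF s(1), of "mat22 1 0 0 0"] mult(1)[OF s(2), of "mat22 0 1 0 0"]
          mult(1)[OF s(3), of "mat22 0 0 1 0"] mult(1)[OF s(4), of "mat22 0 0 0 1"] by auto
      then have "mat22 a 0 0 0 + mat22 0 b 0 0 + (mat22 0 0 c 0 + mat22 0 0 0 d) \<in> Q'"
        by (intro add)
      then show ?thesis by (simp add: Xm)
    qed
    have "nc_prime_ideal Q (class_ring :: 'a ring)"
      unfolding nc_prime_ideal_def
    proof (intro conjI allI impI)
      show "Q \<noteq> carrier (class_ring :: 'a ring)"
      proof
        assume "Q = carrier (class_ring :: 'a ring)"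
        then have "X \<in> Q'" if "X \<in> carrier_mat 2 2" for X
          using over[of X] that by (simp add: M2_over_def)
        then show False using ne I' by (auto simp: ideal_M2_ring_iff)
      qed
    next
      fix I J assume I: "ideal I (class_ring :: 'a ring)" and J: "ideal J (class_ring :: 'a ring)"
        and IJ: "I \<cdot>\<^bsub>class_ring\<^esub> J \<subseteq> Q"
      have pr: "x * y \<in> Q" if "x \<in> I" "y \<in> J" for x y
        using IJ ideal_prod.prod[OF that, of class_ring] by auto
      have sm: "x + y \<in> Q" if "x \<in> Q" "y \<in> Q" for x y
        using Q that by (auto simp: ideal_class_ring_iff)
      \<comment> \<open>Primeness of \<open>Q'\<close> is used on the matrix ideals over
        \<open>I\<close> and \<open>J\<close>: each entry of a product \<open>X * Y\<close> is a sum
        of two products from \<open>I\<close> and \<open>J\<close>, hence lies in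
        \<open>Q\<close>.\<close>
      have "M2_over I \<cdot>\<^bsub>M2_ring TYPE('a)\<^esub> M2_over J \<subseteq> Q'"
      proof
        fix s assume "s \<in> M2_over I \<cdot>\<^bsub>M2_ring TYPE('a)\<^esub> M2_over J"
        then show "s \<in> Q'"
        proof induction
          case (prod X Y)
          then have "X \<in> carrier_mat 2 2" "Y \<in> carrier_mat 2 2" by (simp_all add: M2_over_def)
          then obtain x1 x2 x3 x4 y1 y2 y3 y4
            where "X = mat22 x1 x2 x3 x4" "Y = mat22 y1 y2 y3 y4"
            by (metis mat22_cases)
          then have "X * Y \<in> M2_over Q" using prod by (auto intro!: sm pr)
          then show ?case using over by simp
        qed (use add in auto)
      qed
      then have "M2_over I \<subseteq> Q' \<or> M2_over J \<subseteq> Q'"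
        using Q' ideal_M2_over[OF I] ideal_M2_over[OF J] unfolding nc_prime_ideal_def by blast
      moreover have "K \<subseteq> Q" if "M2_over K \<subseteq> Q'" "ideal K (class_ring :: 'a ring)" for K
      proof
        fix x assume "x \<in> K"
        then have "mat22 x 0 0 x \<in> M2_over K" using that(2) by (simp add: ideal_class_ring_iff)
        then show "x \<in> Q" using that(1) by (auto simp: Q_def)
      qed
      ultimately show "I \<subseteq> Q \<or> J \<subseteq> Q" using I J by blast
    qed (rule Q)
    then have "prime_radical (class_ring :: 'a ring) \<subseteq> Q" by (auto simp: prime_radical_def)
    then show ?thesis using W by (intro over) (auto simp: M2_over_def)
  qed
  then show "W \<in> prime_radical (M2_ring TYPE('a))" using Wc by (simp add: prime_radical_def)
qed


section \<open>Strong pi-regularity\<close>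

text \<open>Every power of an element congruent to 1 modulo multiples of \<open>a\<close> is again
  so; the cofactor \<open>g\<close> is built so that it commutes with \<open>a\<close>.\<close>

lemma (in ring) one_minus_mult_pow:
  assumes "a \<in> carrier R" "c \<in> carrier R" "a \<otimes> c = c \<otimes> a"
  shows "\<exists>g\<in>carrier R. a \<otimes> g = g \<otimes> a \<and> (\<one> \<ominus> a \<otimes> c) [^] (n::nat) = \<one> \<ominus> a \<otimes> g"
proof (induction n)
  case 0
  show ?case using assms by (intro bexI[of _ \<zero>]) (auto simp: minus_eq)
next
  case (Suc n)
  then obtain g where g: "g \<in> carrier R" "a \<otimes> g = g \<otimes> a"
    "(\<one> \<ominus> a \<otimes> c) [^] n = \<one> \<ominus> a \<otimes> g" by blast
  \<comment> \<open>Read off from (1 - ag)(1 - ac) = 1 - a(c + g - gac).\<close>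
  define h where "h = c \<oplus> g \<ominus> g \<otimes> (a \<otimes> c)"
  have h: "h \<in> carrier R" using assms g by (simp add: h_def)
  have gac: "a \<otimes> (g \<otimes> (a \<otimes> c)) = g \<otimes> (a \<otimes> c) \<otimes> a"
    using assms g by (metis m_assoc m_closed)
  have "a \<otimes> h = h \<otimes> a"
    using assms g gac by (simp add: h_def minus_eq r_distr l_distr r_minus l_minus)
  moreover have "(\<one> \<ominus> a \<otimes> c) [^] Suc n = \<one> \<ominus> a \<otimes> h"
  proof -
    have "(\<one> \<ominus> a \<otimes> g) \<otimes> (\<one> \<ominus> a \<otimes> c) = \<one> \<ominus> a \<otimes> h"
      using assms(1,2) g(1)
      by (simp add: h_def minus_eq r_distr l_distr r_minus l_minus minus_add m_assoc a_ac)
    then show ?thesis by (simp add: g(3))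
  qed
  ultimately show ?case using h by blast
qed

text \<open>As \<open>a\<close> commutes with 1 - ac, the hypothesis splits into \<open>a^n\<close>
  (1 - ac)\<open>^n\<close> = 0. The second factor is 1 - ag, which leaves
  \<open>a^n = a^(n+1) g\<close>.\<close>

lemma (in ring) strongly_pi_regularI:
  assumes a: "a \<in> carrier R" and c: "c \<in> carrier R" "a \<otimes> c = c \<otimes> a"
    and n: "n \<ge> 1" and nil: "(a \<otimes> (\<one> \<ominus> a \<otimes> c)) [^] (n::nat) = \<zero>"
  shows "strongly_pi_regular R a"
proof -
  obtain g where g: "g \<in> carrier R" "a \<otimes> g = g \<otimes> a" "(\<one> \<ominus> a \<otimes> c) [^] n = \<one> \<ominus> a \<otimes> g"
    using one_minus_mult_pow[OF a c] by blast
  have "a \<otimes> (\<one> \<ominus> a \<otimes> c) = (\<one> \<ominus> a \<otimes> c) \<otimes> a"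
  proof -
    have "a \<otimes> (a \<otimes> c) = (a \<otimes> c) \<otimes> a" using a c by (metis m_assoc)
    then show ?thesis using a c(1) by (simp add: minus_eq r_distr l_distr r_minus l_minus)
  qed
  then have "\<zero> = a [^] n \<otimes> (\<one> \<ominus> a \<otimes> g)"
    using a c nil pow_mult_distrib[of a "\<one> \<ominus> a \<otimes> c" n] by (simp flip: g(3))
  also have "\<dots> = a [^] n \<ominus> a [^] (n + 1) \<otimes> g"
    using a g by (simp add: minus_eq r_distr r_minus m_assoc)
  finally have "a [^] n = a [^] (n + 1) \<otimes> g"
    using a g(1) minus_equality[of "a [^] n" "\<ominus> (a [^] (n + 1) \<otimes> g)"]
    by (simp add: minus_eq del: nat_pow_Suc)
  then show ?thesis unfolding strongly_pi_regular_def using a g n by blast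
qed

text \<open>Fitting's idempotent for a strongly pi-regular element is \<open>a\<^sup>m b\<^sup>m\<close>; modulo an ideal over which
  \<open>a\<close> is idempotent, \<open>a = a\<^sup>m = a\<^sup>m\<^sup>+\<^sup>1 b = a b\<close>, so this idempotent is congruent to \<open>a\<close>.\<close>

lemma (in ring) strongly_pi_regular_idempotent:
  assumes spr: "strongly_pi_regular R a" and P: "ideal P R" and idem: "a \<otimes> a \<ominus> a \<in> P"
  obtains e where "e \<in> carrier R" "e \<otimes> e = e" "a \<otimes> e = e \<otimes> a" "a \<ominus> e \<in> P"
proof -
  obtain m :: nat and b where a: "a \<in> carrier R" and m: "m \<ge> 1" and b: "b \<in> carrier R"
    and eq: "a [^] m = a [^] (m + 1) \<otimes> b" and ab: "a \<otimes> b = b \<otimes> a"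
    using spr unfolding strongly_pi_regular_def by blast
  note cl = a b
  have comm: "a [^] (k::nat) \<otimes> b [^] (l::nat) = b [^] l \<otimes> a [^] k" for k l
  proof -
    have "b \<otimes> a [^] k = a [^] k \<otimes> b" using group_commutes_pow[of a b k] cl ab by metis
    then show ?thesis using group_commutes_pow[of b "a [^] k" l] cl by (metis nat_pow_closed)
  qed
  \<comment> \<open>Iterating the defining equation \<open>k\<close> times; the case
    \<open>k = m\<close> makes \<open>a^m b^m\<close> idempotent.\<close>
  have shift: "a [^] m = a [^] (m + k) \<otimes> b [^] k" for k :: nat
  proof (induction k)
    case 0
    then show ?case using cl by simp
  next
    case (Suc k)
    have "a [^] (m + Suc k) \<otimes> b [^] Suc k = (a [^] k \<otimes> a [^] (m + 1)) \<otimes> (b \<otimes> b [^] k)"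
      using nat_pow_mult[OF a, of k "m + 1"] nat_pow_Suc2[OF b, of k] by (simp add: add.commute)
    also have "\<dots> = a [^] k \<otimes> (a [^] (m + 1) \<otimes> b) \<otimes> b [^] k"
      using cl by (simp add: m_assoc del: nat_pow_Suc)
    also have "\<dots> = a [^] (m + k) \<otimes> b [^] k"
      using nat_pow_mult[OF a, of k m] by (simp only: eq[symmetric]) (simp add: add.commute)
    finally show ?case using Suc by simp
  qed
  define e where "e = a [^] m \<otimes> b [^] m"
  have e: "e \<in> carrier R" using cl by (simp add: e_def)
  have "e \<otimes> e = (a [^] m \<otimes> (b [^] m \<otimes> a [^] m)) \<otimes> b [^] m"
    using cl by (simp add: e_def m_assoc)
  also have "\<dots> = (a [^] (m + m) \<otimes> b [^] m) \<otimes> b [^] m"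
    using cl by (simp only: comm[symmetric]) (simp add: m_assoc flip: nat_pow_mult)
  finally have ee: "e \<otimes> e = e" by (simp only: e_def shift[symmetric])
  have ae: "a \<otimes> e = e \<otimes> a"
  proof -
    have "a \<otimes> e = (a \<otimes> a [^] m) \<otimes> b [^] m" using cl by (simp add: e_def m_assoc)
    \<comment> \<open>The factor \<open>a\<close> is written as a first power so that
      \<open>comm\<close> can move it past \<open>b [^] m\<close>.\<close>
    also have "\<dots> = a [^] m \<otimes> (a [^] (1::nat) \<otimes> b [^] m)"
      using cl nat_pow_Suc2[OF a, of m] by (simp flip: m_assoc)
    also have "\<dots> = e \<otimes> a" unfolding comm using cl by (simp add: e_def m_assoc)
    finally show ?thesis .
  qed
  interpret P: ideal P R by fact
  interpret Q: ring "R Quot P" by (rule P.quotient_is_ring)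
  interpret h: ring_hom_ring R "R Quot P" "(+>) P" by (rule P.rcos_ring_hom_ring)
  let ?a = "P +> a" and ?b = "P +> b"
  have cla: "?a \<in> carrier (R Quot P)" "?b \<in> carrier (R Quot P)" using cl by auto
  have aa: "?a \<otimes>\<^bsub>R Quot P\<^esub> ?a = ?a"
    using idem quotient_eq_iff_same_a_r_cos[OF P, of "a \<otimes> a" a] cl by simp
  have apow: "?a [^]\<^bsub>R Quot P\<^esub> k = ?a" if "k \<ge> 1" for k :: nat
    using that by (induction k rule: dec_induct) (use cla aa in auto)
  have "?a = ?a \<otimes>\<^bsub>R Quot P\<^esub> ?b"
    using arg_cong[OF eq, of "(+>) P"] cl m apow[of m] apow[of "m + 1"]
    by (simp add: h.hom_nat_pow del: nat_pow_Suc Q.nat_pow_Suc)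
  then have "?a = ?a \<otimes>\<^bsub>R Quot P\<^esub> ?b [^]\<^bsub>R Quot P\<^esub> k" for k :: nat
    by (induction k) (use cla in \<open>auto simp flip: Q.m_assoc\<close>)
  then have "?a = P +> e" using cl apow[OF m] by (simp add: e_def h.hom_nat_pow)
  then have "a \<ominus> e \<in> P" using quotient_eq_iff_same_a_r_cos[OF P a e] by simp
  then show thesis using that e ee ae by blast
qed

section \<open>Companion matrices over a local ring\<close>

text \<open>The assumption says that x = (v, w) is a cyclic vector: the matrix with columns x and Ax
  has unit determinant. In this basis Cayley-Hamilton, AAx = tr(A) Ax - det(A) x, gives the
  companion matrix.\<close>

lemma similar_companion:
  fixes a :: "'a::comm_ring_1"
  assumes "v * (c * v + d * w) - w * (a * v + b * w) dvd 1"
  shows "similar_mat (mat22 a b c d) (mat22 0 (b * c - a * d) 1 (a + d))"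
proof -
  define v' w' where "v' = a * v + b * w" and "w' = c * v + d * w"
  obtain u where u: "(v * w' - w * v') * u = 1"
    using assms by (auto simp: dvd_def v'_def w'_def)
  let ?A = "mat22 a b c d" and ?C = "mat22 0 (b * c - a * d) 1 (a + d)"
  \<comment> \<open>\<open>?P\<close> has columns x and Ax; \<open>?Q\<close> is its adjugate times
    the inverse \<open>u\<close> of its determinant.\<close>
  let ?P = "mat22 v v' w w'" and ?Q = "mat22 (w' * u) (- v' * u) (- w * u) (v * u)"
  have PQ: "?P * ?Q = 1\<^sub>m 2" "?Q * ?P = 1\<^sub>m 2"
    using u by (simp_all add: mat22_one algebra_simps)
  have AP: "?A * ?P = ?P * ?C" by (simp add: v'_def w'_def algebra_simps)
  have "?A = ?A * (?P * ?Q)" unfolding PQ by (rule right_mult_one_mat[symmetric, OF mat22_carrier])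
  also have "\<dots> = ?A * ?P * ?Q"
    by (rule assoc_mult_mat[symmetric]) (rule mat22_carrier)+
  finally have "?A = ?P * ?C * ?Q" by (simp only: AP)
  then show ?thesis by (intro similar_matI[OF _ PQ]) auto
qed

text \<open>One of the vectors \<open>(1, 0)\<close>, \<open>(0, 1)\<close>, \<open>(1, 1)\<close> is cyclic.\<close>

lemma local_cring_similar_companion:
  fixes a :: "'a::comm_ring_1"
  assumes loc: "local_cring (class_ring :: 'a ring)"
    and tr: "a + d dvd 1" and det: "\<not> a * d - b * c dvd 1"
  shows "similar_mat (mat22 a b c d) (mat22 0 (b * c - a * d) 1 (a + d))"
proof -
  note add = local_cring_nonunit_add[OF loc]
  \<comment> \<open>For (1, 0), (0, 1) and (1, 1) the determinant to be inverted is c, -b and c + d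
    - (a + b) respectively.\<close>
  consider "c dvd 1" | "b dvd 1" | "\<not> b dvd 1" "\<not> c dvd 1" by blast
  then show ?thesis
  proof cases
    case 1
    then show ?thesis by (intro similar_companion[where v = 1 and w = 0]) simp
  next
    case 2
    then show ?thesis by (intro similar_companion[where v = 0 and w = 1]) simp
  next
    case 3
    have "\<not> b * c dvd 1" using 3 dvd_mult_left by blast
    then have "\<not> a * d dvd 1" using add[OF det, of "b * c"] by simp
    then have ad: "\<not> a dvd 1 \<or> \<not> d dvd 1" using mult_dvd_mono[of a 1 d 1] by auto
    \<comment> \<open>One of \<open>a\<close>, \<open>d\<close> is a nonunit. If
      \<open>d - a\<close> were one too, both would be, and so would the trace
      \<open>a + d\<close>.\<close>
    have "d - a dvd 1"
    proof (rule ccontr)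
      assume na: "\<not> d - a dvd 1"
      have "\<not> d dvd 1" if "\<not> a dvd 1" using add[OF na that] by simp
      moreover have "\<not> a dvd 1" if "\<not> d dvd 1" using add[OF na, of "- d"] that by simp
      ultimately have "\<not> a dvd 1" "\<not> d dvd 1" using ad by blast+
      then show False using add tr by blast
    qed
    moreover have "\<not> d - a dvd 1" if "\<not> c + d - (a + b) dvd 1"
      using add[OF add[OF that 3(1)], of "- c"] 3(2) by simp
    ultimately have "c + d - (a + b) dvd 1" by blast
    then show ?thesis by (intro similar_companion[where v = 1 and w = 1]) simp
  qed
qed

section \<open>Nilpotent determinants, idempotents, and companion matrices modulo an ideal\<close>

lemma prime_radical_nonunit:
  assumes "x \<in> prime_radical (class_ring :: 'a::comm_ring_1 ring)"
  shows "\<not> x dvd 1"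
proof
  assume "x dvd 1"
  obtain n where "x ^ n = 0" using prime_radical_nilpotent[OF assms] by blast
  then show False using dvd_power_same[OF \<open>x dvd 1\<close>, of n] by simp
qed

text \<open>With \<open>u\<close> the inverse of the trace, Cayley-Hamilton turns A(1 - uA) into the
  scalar matrix of u det(A), which is nilpotent; \<open>strongly_pi_regularI\<close> then applies to
  the scalar matrix of \<open>u\<close>.\<close>

lemma strongly_pi_regular_mat22:
  fixes a :: "'a::comm_ring_1"
  assumes tr: "a + d dvd 1" and det: "(a * d - b * c) ^ n = 0"
  shows "strongly_pi_regular (M2_ring TYPE('a)) (mat22 a b c d)"
proof -
  interpret ring "M2_ring TYPE('a)" by (rule ring_M2_ring)
  obtain u where u: "(a + d) * u = 1" using tr by (auto simp: dvd_def)
  define s where "s = u * (a * d - b * c)"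
  have pow: "mat22 s 0 0 s [^]\<^bsub>M2_ring TYPE('a)\<^esub> k = mat22 (s ^ k) 0 0 (s ^ k)" for k :: nat
    by (induction k) (simp_all add: mult.commute)
  have x: "x - x * u * (a + d) = 0" for x
    using u by (metis mult.assoc mult.commute mult_1_right right_minus_eq)
  have "mat22 a b c d * (mat22 1 0 0 1 - mat22 a b c d * mat22 u 0 0 u) = mat22 s 0 0 s"
    using x[of a] x[of b] x[of c] x[of d] by (simp add: s_def algebra_simps)
  moreover have "s ^ n = 0" using det by (simp add: s_def power_mult_distrib)
  moreover have "n \<noteq> 0" using det by (metis power_0 zero_neq_one)
  ultimately show ?thesis
    by (intro strongly_pi_regularI[where c = "mat22 u 0 0 u" and n = n])
      (simp_all add: M2_ring_minus pow mult.commute del: mat22_ops(2))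
qed

text \<open>The determinant is idempotent, hence 0 or 1. If it is 1, the matrix is invertible and so
  the identity; if it is 0, the trace is idempotent as well, and trace 0 forces the zero
  matrix.\<close>

lemma idempotent_mat22_cases:
  fixes a :: "'a::comm_ring_1"
  assumes loc: "local_cring (class_ring :: 'a ring)"
    and idem: "mat22 a b c d * mat22 a b c d = mat22 a b c d"
  shows "mat22 a b c d = 0\<^sub>m 2 2 \<or> mat22 a b c d = 1\<^sub>m 2 \<or> a + d = 1 \<and> a * d - b * c = 0"
proof -
  have e: "a * a + b * c = a" "a * b + b * d = b" "c * a + d * c = c" "c * b + d * d = d"
    using idem by simp_all
  have "(a * d - b * c) * (a * d - b * c) =
      (a * a + b * c) * (c * b + d * d) - (a * b + b * d) * (c * a + d * c)"
    by (simp add: algebra_simps)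
  then have "(a * d - b * c) * (a * d - b * c) = a * d - b * c"
    by (simp only: e)
  then consider "a * d - b * c = 0" | "a * d - b * c = 1"
    using local_cring_idempotent[OF loc] by blast
  then show ?thesis
  proof cases
    case 1
    \<comment> \<open>The identity \<open>tr(E)^2 = tr(E^2) + 2 det(E)\<close>.\<close>
    have "(a + d) * (a + d) = (a * a + b * c) + (c * b + d * d) + 2 * (a * d - b * c)"
      by (simp add: algebra_simps)
    then have "(a + d) * (a + d) = a + d" by (simp only: e 1) simp
    then consider "a + d = 0" | "a + d = 1" using local_cring_idempotent[OF loc] by blast
    then show ?thesis
    proof cases
      case t: 1
      \<comment> \<open>Cayley-Hamilton entrywise, with \<open>E^2\<close> replaced by
        \<open>E\<close>.\<close>
      have "a = (a + d) * a - (a * d - b * c)" "b = (a + d) * b" "c = (a + d) * c"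
        "d = (a + d) * d - (a * d - b * c)"
        using e by (simp_all add: algebra_simps)
      then have "a = 0" "b = 0" "c = 0" "d = 0" by (simp_all only: t 1)  simp_all
      then show ?thesis by (simp add: mat22_zero)
    next
      case 2
      then show ?thesis using 1 by simp
    qed
  next
    case 2
    \<comment> \<open>Multiply \<open>E\<^sup>2 = E\<close> by the adjugate of \<open>E\<close>.\<close>
    have "(a * d - b * c) * a = d * (a * a + b * c) - b * (c * a + d * c)"
      "(a * d - b * c) * b = d * (a * b + b * d) - b * (c * b + d * d)"
      "(a * d - b * c) * c = a * (c * a + d * c) - c * (a * a + b * c)"
      "(a * d - b * c) * d = a * (c * b + d * d) - c * (a * b + b * d)"
      by (simp_all add: algebra_simps)
    then have "a = d * a - b * c" "b = d * b - b * d" "c = a * c - c * a" "d = a * d - c * b"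
      by (simp_all only: e 2 mult_1)
    then have "a = 1" "b = 0" "c = 0" "d = 1" using 2 by (simp_all add: mult.commute)
    then show ?thesis by (simp add: mat22_one)
  qed
qed

text \<open>Modulo \<open>I\<close> the companion matrix has rows (0, 0) and (1, 1), which is
  idempotent; conjugation preserves the ideal \<open>M2_over I\<close>.\<close>

lemma similar_companion_idempotent_mod:
  fixes A :: "'a::comm_ring_1 mat"
  assumes I: "ideal I (class_ring :: 'a ring)" and l: "l \<in> I" and m: "m \<in> I"
    and A: "A \<in> carrier_mat 2 2" and sim: "similar_mat A (mat22 0 l 1 (1 + m))"
  shows "A * A - A \<in> M2_over I"
proof -
  let ?C = "mat22 0 l 1 (1 + m)"
  obtain P Q where w: "similar_mat_wit A ?C P Q" using sim by (auto simp: similar_mat_def)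
  note D = similar_mat_witD2[OF A w]
  note c = D(5-7)
  have "A * A = P * ?C * (Q * P) * ?C * Q"
    unfolding D(3) using c by (simp add: assoc_mult_mat[of _ 2 2 _ 2 _ 2] mult_carrier_mat[of _ 2 2 _ 2] del: mat22_ops)
  also have "\<dots> = P * (?C * ?C) * Q"
    unfolding D(2) using c by (simp add: assoc_mult_mat[of _ 2 2 _ 2 _ 2] mult_carrier_mat[of _ 2 2 _ 2] del: mat22_ops)
  finally have AA: "A * A = P * (?C * ?C) * Q" .
  have "A * A - A = (P * (?C * ?C) - P * ?C) * Q"
    unfolding AA using c
    by (subst minus_mult_distrib_mat[of _ 2 2 _ _ 2])
      (simp_all add: D(3)[symmetric] mult_carrier_mat[of _ 2 2 _ 2] del: mat22_ops)
  also have "P * (?C * ?C) - P * ?C = P * (?C * ?C - ?C)"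
    by (rule mult_minus_distrib_mat[symmetric, OF c(2) mult_carrier_mat]) (rule mat22_carrier)+
  finally have "A * A - A = P * (?C * ?C - ?C) * Q" .
  moreover have "?C * ?C - ?C \<in> M2_over I"
  proof -
    have "?C * ?C - ?C = mat22 l (m * l) m (l + (1 + m) * m)" by (simp add: algebra_simps)
    moreover have "mat22 l (m * l) m (l + (1 + m) * m) \<in> M2_over I"
      using I l m by (simp add: ideal_class_ring_iff)
    ultimately show ?thesis by (simp only:)
  qed
  ultimately show ?thesis using ideal_M2_over[OF I] c by (simp add: ideal_M2_ring_iff)
qed

section \<open>The characterization of strongly P-clean matrices\<close>

theorem theorem5p4:
  fixes A :: "'a::comm_ring_1 mat"
  assumes "local_cring (class_ring :: 'a ring)"
    and "A \<in> carrier_mat 2 2"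
  shows "strongly_P_clean (M2_ring TYPE('a)) A \<longleftrightarrow>
      A \<in> M2_over (prime_radical (class_ring :: 'a ring))
    \<or> 1\<^sub>m 2 - A \<in> M2_over (prime_radical (class_ring :: 'a ring))
    \<or> (strongly_pi_regular (M2_ring TYPE('a)) A \<and>
        (\<exists>l \<in> prime_radical (class_ring :: 'a ring).
         \<exists>m \<in> (+) 1 ` prime_radical (class_ring :: 'a ring).
           similar_mat A (mat_of_rows_list 2 [[0, l], [1, m]])))"
    (is "?clean \<longleftrightarrow> ?zero \<or> ?one \<or> ?pi")
proof -
  let ?P = "prime_radical (class_ring :: 'a ring)"
  let ?S = "M2_ring TYPE('a)"
  note loc = assms(1)
  interpret S: ring ?S by (rule ring_M2_ring)
  have Padd: "\<And>x y. x \<in> ?P \<Longrightarrow> y \<in> ?P \<Longrightarrow> x + y \<in> ?P"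
    and Pmult: "\<And>r x. x \<in> ?P \<Longrightarrow> r * x \<in> ?P"
    using ideal_prime_radical[where ?'a='a] unfolding ideal_class_ring_iff by blast+
  have Pneg: "- x \<in> ?P" if "x \<in> ?P" for x using Pmult[OF that, of "- 1"] by simp
  obtain a b c d where A: "A = mat22 a b c d" using assms(2) by (rule mat22_cases)
  show ?thesis
  proof (intro iffI)
    assume ?clean
    then obtain E W where E: "E \<in> carrier_mat 2 2" and W: "W \<in> M2_over ?P" and idem: "E * E = E"
      and AEW: "A = E + W"
      by (auto simp: strongly_P_clean_def prime_radical_M2_ring)
    obtain e1 e2 e3 e4 where Em: "E = mat22 e1 e2 e3 e4" using E by (rule mat22_cases)
    have "W \<in> carrier_mat 2 2" using W by (simp add: M2_over_def)
    then obtain w1 w2 w3 w4 where Wm: "W = mat22 w1 w2 w3 w4" by (rule mat22_cases)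
    have w: "w1 \<in> ?P" "w2 \<in> ?P" "w3 \<in> ?P" "w4 \<in> ?P" using W by (simp_all add: Wm)
    have eq: "a = e1 + w1" "b = e2 + w2" "c = e3 + w3" "d = e4 + w4"
      using AEW by (simp_all add: A Em Wm)
    consider "E = 0\<^sub>m 2 2" | "E = 1\<^sub>m 2" | "e1 + e4 = 1" "e1 * e4 - e2 * e3 = 0"
      using idempotent_mat22_cases[OF loc] idem unfolding Em by blast
    then show "?zero \<or> ?one \<or> ?pi"
    proof cases
      case 1
      then have ?zero using W AEW by (simp add: mat22_zero Wm)
      then show ?thesis ..
    next
      case 2
      then have ?one using w AEW by (simp add: mat22_one Wm Pneg)
      then show ?thesis by simp
    next
      case 3
      have tr: "a + d = 1 + (w1 + w4)" unfolding eq 3(1)[symmetric] by (simp add: algebra_simps)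
      have trP: "w1 + w4 \<in> ?P" using w Padd by blast
      \<comment> \<open>Each term beyond the determinant of \<open>E\<close> ends in an entry of
        \<open>W\<close>, so \<open>Pmult\<close> applies to it.\<close>
      have "a * d - b * c = e1 * e4 - e2 * e3 +
          (d * w1 + (e1 * w4 + (- c * w2 + - e2 * w3)))"
        unfolding eq by (simp add: algebra_simps)
      then have detP: "a * d - b * c \<in> ?P" using w by (simp only: 3(2) add_0) (intro Padd Pmult)
      have unit: "a + d dvd 1"
      proof (rule ccontr)
        assume "\<not> a + d dvd 1"
        then show False
          \<comment> \<open>Otherwise 1 = (a + d) - (w1 + w4) would be a sum of two
            nonunits.\<close>
          using local_cring_nonunit_add[OF loc, of "a + d" "- (w1 + w4)"] prime_radical_nonunit[OF trP]
          by (simp add: tr del: minus_add_distrib)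
      qed
      obtain n where n: "(a * d - b * c) ^ n = 0" using prime_radical_nilpotent[OF detP] by blast
      have "strongly_pi_regular ?S A" unfolding A by (rule strongly_pi_regular_mat22[OF unit n])
      moreover have "similar_mat A (mat22 0 (b * c - a * d) 1 (a + d))"
        unfolding A by (rule local_cring_similar_companion[OF loc unit prime_radical_nonunit[OF detP]])
      moreover have "b * c - a * d \<in> ?P" using Pneg[OF detP] by simp
      moreover have "a + d \<in> (+) 1 ` ?P" using trP tr by blast
      ultimately show ?thesis unfolding mat22_def by blast
    qed
  next
    assume "?zero \<or> ?one \<or> ?pi"
    then consider ?zero | ?one | ?pi by blast
    then show ?clean
    proof cases
      case 1
      then show ?thesis unfolding strongly_P_clean_def prime_radical_M2_ring
        by (intro bexI[of _ "mat22 0 0 0 0"] bexI[of _ A]) (simp_all add: A)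
    next
      case 2
      then have "A - 1\<^sub>m 2 \<in> M2_over ?P"
        using Pneg[of "1 - a"] Pneg[of "- b"] Pneg[of "- c"] Pneg[of "1 - d"]
        by (simp add: A mat22_one)
      then show ?thesis unfolding strongly_P_clean_def prime_radical_M2_ring
        by (intro bexI[of _ "mat22 1 0 0 1"] bexI[of _ "A - 1\<^sub>m 2"]) (simp_all add: A mat22_one)
    next
      case 3
      then obtain l m where "l \<in> ?P" "m \<in> ?P" "similar_mat A (mat22 0 l 1 (1 + m))"
        unfolding mat22_def by blast
      then have "A * A - A \<in> M2_over ?P"
        using similar_companion_idempotent_mod[OF ideal_prime_radical] assms(2) by blast
      then have "A \<otimes>\<^bsub>?S\<^esub> A \<ominus>\<^bsub>?S\<^esub> A \<in> M2_over ?P"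
        using assms(2) by (simp add: M2_ring_minus)
      \<comment> \<open>Fitting's idempotent of \<open>A\<close>, congruent to \<open>A\<close>
        modulo the prime radical of the matrix ring; the radical part is then
        \<open>A - E\<close>.\<close>
      then obtain E where E: "E \<in> carrier_mat 2 2" "E * E = E" "A * E = E * A" "A - E \<in> M2_over ?P"
        using S.strongly_pi_regular_idempotent[of A "M2_over ?P"] 3
          ideal_M2_over[OF ideal_prime_radical] assms(2)
        by (metis M2_ring_minus M2_ring_simps(1,5))
      have "A = E + (A - E)" "E * (A - E) = (A - E) * E"
      proof -
        show "A = E + (A - E)" using E(1) by (elim mat22_cases) (simp add: A)
        show "E * (A - E) = (A - E) * E"
          using E(1-3) assms(2)
          by (simp add: mult_minus_distrib_mat[of _ 2 2 _ 2] minus_mult_distrib_mat[of _ 2 2 _ _ 2])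
      qed
      then show ?thesis unfolding strongly_P_clean_def prime_radical_M2_ring
        using E by (intro bexI[of _ E] bexI[of _ "A - E"]) auto
    qed
  qed
qed

end
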